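(* Fix a bijection $\pi:\omega\times\omega\to\omega$ and define $B^*\subseteq {}^{\omega}2\times {}^{\omega}2$ by: $(x,y)\in B^*$ if and only if \[x=y\ \vee\ (\exists k\in\omega)(\forall n\in\omega)\big(x(n)=y(\pi(n,k))\big)\ \vee\ (\exists k\in\omega)(\forall n\in\omega)\big(y(n)=x(\pi(n,k))\big).\] Then: (1) There is an uncountable set $X\subseteq {}^{\omega}2$ such that $X\times X\subseteq B^*$. (2) There is no perfect set $P\subseteq {}^{\omega}2$ such that $P\times P\subseteq B^*$.
   Context: ${}^{\omega}2$ is the Cantor space of all infinite sequences $x:\omega\to\{0,1\}$ with the product topology. A perfect set is a nonempty closed set with no isolated points. *)

theory Defs
  imports "HOL-Analysis.Analysis"
begin

text \<open>The Cantor space is the type of functions from \<open>nat\<close> to \<open>bool\<close>. The library topology on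
  function types is the product topology, and \<open>bool\<close> carries the discrete topology.\<close>

type_synonym cantor = "nat \<Rightarrow> bool"

definition perfect_set :: "'a::topological_space set \<Rightarrow> bool" where
  "perfect_set P \<longleftrightarrow> P \<noteq> {} \<and> closed P \<and> \<not> (\<exists>x. x isolated_in P)"

definition Bstar :: "(nat \<times> nat \<Rightarrow> nat) \<Rightarrow> (cantor \<times> cantor) set" where
  "Bstar \<pi> = {(x, y). x = y \<or> (\<exists>k. \<forall>n. x n = y (\<pi> (n, k))) \<or> (\<exists>k. \<forall>n. y n = x (\<pi> (n, k)))}"

end

theory Submission
  imports Defs
begin

text \<open>
  Call \<open>\<lambda>n. y (\<pi> (n, k))\<close> the \<open>k\<close>-th column of \<open>y\<close>. Two points are related by \<open>Bstar \<pi>\<close> iff they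
  are equal or one of them is a column of the other.

  Since \<open>\<pi>\<close> is injective, any sequence of points can be prescribed as the columns of a single point.
  So a countable set \<open>X\<close> all of whose elements are related can always be enlarged: reserve one
  column for a free parameter and list \<open>X\<close> in the others. The points obtained are related to all
  of \<open>X\<close>, and as there are uncountably many of them, one lies outside \<open>X\<close>. Hence a maximal set with
  related elements, which Zorn's lemma provides, is uncountable.

  On the other hand \<open>Bstar \<pi>\<close> is covered by the graphs, and the transposed graphs, of countably many
  continuous maps: the identity and the maps taking a point to its \<open>k\<close>-th column. For a perfect set
  \<open>P\<close> the trace of each such graph on \<open>P \<times> P\<close> is closed. It has empty interior, because a graph
  containing a box \<open>U \<times> V\<close> forces one side of the box to be a single, hence isolated, point. By the
  Baire category theorem these traces do not cover \<open>P \<times> P\<close>.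
\<close>

section \<open>An uncountable set of related points\<close>

lemma uncountable_cantor: "uncountable (UNIV :: cantor set)"
proof
  assume "countable (UNIV :: cantor set)"
  then obtain e :: "nat \<Rightarrow> cantor" where e: "range e = UNIV"
    using uncountable_def by blast
  obtain n where "e n = (\<lambda>n. \<not> e n n)"
    using e by (metis surjD)
  then show False
    by meson
qed

lemma exists_prescribed_columns:
  fixes \<pi> :: "nat \<times> nat \<Rightarrow> nat" and c :: "nat \<Rightarrow> cantor"
  assumes "inj \<pi>"
  shows "\<exists>z. \<forall>k n. z (\<pi> (n, k)) = c k n"
proof (intro exI allI)
  fix k n
  show "(\<lambda>m. case inv \<pi> m of (n, k) \<Rightarrow> c k n) (\<pi> (n, k)) = c k n"
    using assms by simp
qed

text \<open>Column \<open>0\<close> carries the free parameter \<open>w\<close>. It can be read off from the point, so distinct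
  parameters give distinct points, and only countably many of these lie in \<open>X\<close>.\<close>

lemma exists_new_point_with_columns:
  fixes \<pi> :: "nat \<times> nat \<Rightarrow> nat" and X :: "cantor set"
  assumes "inj \<pi>" and "countable X"
  obtains z where "z \<notin> X" and "\<And>x. x \<in> X \<Longrightarrow> \<exists>k. \<forall>n. x n = z (\<pi> (n, k))"
proof -
  obtain e :: "nat \<Rightarrow> cantor" where e: "X \<subseteq> range e"
    using \<open>countable X\<close> by (metis empty_subsetI equalityE uncountable_def)
  have "\<forall>w. \<exists>z. \<forall>k n. z (\<pi> (n, k)) = case_nat w e k n"
    using exists_prescribed_columns[OF \<open>inj \<pi>\<close>] by (rule allI)
  then obtain code where code: "\<And>w k n. code w (\<pi> (n, k)) = case_nat w e k n"
    by metis
  have "(\<lambda>n. code w (\<pi> (n, 0))) = w" for w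
    by (simp add: code)
  then have "inj code"
    by (intro inj_on_inverseI[where g = "\<lambda>z n. z (\<pi> (n, 0))"])
  then have "uncountable (range code)"
    using uncountable_cantor countable_image_inj_on by blast
  then have "\<not> range code \<subseteq> X"
    using \<open>countable X\<close> countable_subset by blast
  then obtain w where "code w \<notin> X"
    by blast
  moreover have "\<exists>k. \<forall>n. x n = code w (\<pi> (n, k))" if "x \<in> X" for x
  proof -
    obtain i where "x = e i"
      using e \<open>x \<in> X\<close> by blast
    then have "\<forall>n. x n = code w (\<pi> (n, Suc i))"
      by (simp add: code)
    then show ?thesis ..
  qed
  ultimately show ?thesis
    using that by blast
qed

lemma exists_uncountable_square_in_Bstar:
  assumes "inj \<pi>"
  shows "\<exists>X. uncountable X \<and> X \<times> X \<subseteq> Bstar \<pi>"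
proof -
  let ?S = "{X. X \<times> X \<subseteq> Bstar \<pi>}"
  have "\<Union>C \<in> ?S" if "subset.chain ?S C" for C
  proof -
    have "(x, y) \<in> Bstar \<pi>" if "x \<in> X" "y \<in> Y" "X \<in> C" "Y \<in> C" for x y X Y
    proof -
      have "X \<subseteq> Y \<or> Y \<subseteq> X" "X \<times> X \<subseteq> Bstar \<pi>" "Y \<times> Y \<subseteq> Bstar \<pi>"
        using \<open>subset.chain ?S C\<close> that by (auto simp: subset_chain_def)
      then show ?thesis
        using that by blast
    qed
    then show ?thesis
      by auto
  qed
  moreover have "?S \<noteq> {}"
    by blast
  ultimately have "\<exists>M\<in>?S. \<forall>X\<in>?S. M \<subseteq> X \<longrightarrow> X = M"
    by (intro subset_Zorn_nonempty)
  then obtain M where "M \<in> ?S" and max: "\<And>X. X \<in> ?S \<Longrightarrow> M \<subseteq> X \<Longrightarrow> X = M"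
    by (elim bexE) simp
  then have M: "M \<times> M \<subseteq> Bstar \<pi>"
    by simp
  have "uncountable M"
  proof
    assume "countable M"
    then obtain z where "z \<notin> M" and z: "\<And>x. x \<in> M \<Longrightarrow> \<exists>k. \<forall>n. x n = z (\<pi> (n, k))"
      using exists_new_point_with_columns[OF assms] by metis
    have "insert z M \<times> insert z M \<subseteq> Bstar \<pi>"
      using M z by (auto simp: Bstar_def)
    then have "insert z M \<in> ?S"
      by simp
    with max[of "insert z M"] \<open>z \<notin> M\<close> show False
      by blast
  qed
  with M show ?thesis
    by blast
qed

section \<open>Countably many graphs do not cover the square of a perfect set\<close>

lemma closedin_graph_on_square:
  fixes Y :: "'a topology" and P :: "'a set"
  assumes "Hausdorff_space Y" and f: "continuous_map Y Y f"
  defines "T \<equiv> subtopology Y P"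
  shows "closedin (prod_topology T T) {(x, y) \<in> topspace T \<times> topspace T. x = f y}"
    and "closedin (prod_topology T T) {(x, y) \<in> topspace T \<times> topspace T. y = f x}"
proof -
  let ?TT = "prod_topology T T"
  have "continuous_map T Y id"
    unfolding T_def by (simp add: continuous_map_from_subtopology)
  then have fst: "continuous_map ?TT Y fst" and snd: "continuous_map ?TT Y snd"
    using continuous_map_compose[OF continuous_map_fst] continuous_map_compose[OF continuous_map_snd]
    by fastforce+
  have "continuous_map ?TT Y (\<lambda>p. f (fst p))" "continuous_map ?TT Y (\<lambda>p. f (snd p))"
    using continuous_map_compose[OF fst f] continuous_map_compose[OF snd f] by (simp_all add: o_def)
  then have "closedin ?TT {p \<in> topspace ?TT. fst p = f (snd p)}"
    and "closedin ?TT {p \<in> topspace ?TT. snd p = f (fst p)}"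
    using fst snd closedin_continuous_maps_eq[OF \<open>Hausdorff_space Y\<close>] by blast+
  then show "closedin (prod_topology T T) {(x, y) \<in> topspace T \<times> topspace T. x = f y}"
    and "closedin (prod_topology T T) {(x, y) \<in> topspace T \<times> topspace T. y = f x}"
    by (simp_all add: case_prod_unfold mem_Times_iff)
qed

text \<open>If the graph contains a box \<open>U \<times> V\<close>, then for a fixed \<open>b \<in> V\<close> every point of \<open>U\<close> equals \<open>f b\<close>,
  so \<open>U\<close> is an open singleton. In the transposed case the same happens to \<open>V\<close>.\<close>

lemma interior_of_graph_empty:
  assumes no_isolated: "\<And>a. \<not> openin T {a}"
  shows "prod_topology T T interior_of {(x, y) \<in> topspace T \<times> topspace T. x = f y} = {}"
    and "prod_topology T T interior_of {(x, y) \<in> topspace T \<times> topspace T. y = f x} = {}"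
proof -
  \<comment> \<open>A graph and its transpose are both sets with the following one-sided uniqueness.\<close>
  have empty: "prod_topology T T interior_of G = {}"
    if G: "(\<forall>x x' y. (x, y) \<in> G \<and> (x', y) \<in> G \<longrightarrow> x = x') \<or>
           (\<forall>x y y'. (x, y) \<in> G \<and> (x, y') \<in> G \<longrightarrow> y = y')" for G
  proof (rule ccontr)
    assume "prod_topology T T interior_of G \<noteq> {}"
    then obtain a b where "(a, b) \<in> prod_topology T T interior_of G"
      by auto
    then obtain U V where "openin T U" "openin T V" "a \<in> U" "b \<in> V"
      and "U \<times> V \<subseteq> prod_topology T T interior_of G"
      using openin_prod_topology_alt[of T T "prod_topology T T interior_of G"]
      by (metis openin_interior_of)
    moreover from this have "U \<times> V \<subseteq> G"
      using interior_of_subset by (metis order_trans)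
    ultimately have "U = {a} \<or> V = {b}"
      using G by blast
    with no_isolated \<open>openin T U\<close> \<open>openin T V\<close> show False
      by metis
  qed
  show "prod_topology T T interior_of {(x, y) \<in> topspace T \<times> topspace T. x = f y} = {}"
    and "prod_topology T T interior_of {(x, y) \<in> topspace T \<times> topspace T. y = f x} = {}"
    by (rule empty; simp)+
qed

text \<open>The square of \<open>P\<close> is a compact Hausdorff space, hence a Baire space, and each graph or
  transposed graph is nowhere dense in it. With \<open>id \<in> F\<close> the two points are also distinct.\<close>

lemma exists_pair_outside_graphs:
  fixes F :: "('a \<Rightarrow> 'a) set"
  assumes "compact_space Y" and "Hausdorff_space Y"
    and "countable F" and cont: "\<And>f. f \<in> F \<Longrightarrow> continuous_map Y Y f"
    and "closedin Y P" and "P \<noteq> {}" and no_isolated: "\<And>a. \<not> openin (subtopology Y P) {a}"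
  obtains x y where "x \<in> P" "y \<in> P" "\<And>f. f \<in> F \<Longrightarrow> x \<noteq> f y \<and> y \<noteq> f x"
proof -
  define T where "T = subtopology Y P"
  define TT where "TT = prod_topology T T"
  define graph where "graph f = {(x, y) \<in> topspace T \<times> topspace T. x = f y}" for f
  define graph' where "graph' f = {(x, y) \<in> topspace T \<times> topspace T. y = f x}" for f
  have topspace_T: "topspace T = P"
    using \<open>closedin Y P\<close> by (simp add: T_def closedin_subset inf_absorb2)
  have "compact_space T"
    using assms by (simp add: T_def closedin_compact_space compact_space_subtopology)
  moreover have "Hausdorff_space T"
    using assms by (simp add: T_def Hausdorff_space_subtopology)
  ultimately have "compact_space TT" "Hausdorff_space TT"
    by (simp_all add: TT_def compact_space_prod_topology Hausdorff_space_prod_topology)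
  then have "locally_compact_space TT \<and> regular_space TT"
    by (simp add: compact_imp_locally_compact_space compact_Hausdorff_imp_regular_space)
  moreover have "countable (graph ` F \<union> graph' ` F)"
    using \<open>countable F\<close> by simp
  moreover have "closedin TT G \<and> TT interior_of G = {}" if "G \<in> graph ` F \<union> graph' ` F" for G
    using that cont closedin_graph_on_square[OF \<open>Hausdorff_space Y\<close>]
      interior_of_graph_empty[of T] no_isolated
    unfolding T_def TT_def graph_def graph'_def by blast
  ultimately have "TT interior_of \<Union> (graph ` F \<union> graph' ` F) = {}"
    by (intro Baire_category_alt) auto
  then have "\<Union> (graph ` F \<union> graph' ` F) \<noteq> topspace TT"
    using \<open>P \<noteq> {}\<close> topspace_T interior_of_topspace[of TT] by (auto simp: TT_def)
  moreover have "\<Union> (graph ` F \<union> graph' ` F) \<subseteq> topspace TT"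
    by (auto simp: TT_def graph_def graph'_def)
  ultimately obtain x y where "(x, y) \<in> topspace TT" "(x, y) \<notin> \<Union> (graph ` F \<union> graph' ` F)"
    by (metis subset_antisym subsetI surj_pair)
  then have "x \<in> P" "y \<in> P" "\<And>f. f \<in> F \<Longrightarrow> x \<noteq> f y \<and> y \<noteq> f x"
    by (auto simp: TT_def topspace_T graph_def graph'_def)
  then show ?thesis
    using that by blast
qed

lemma compact_Hausdorff_cantor:
  "compact_space (euclidean :: cantor topology)" "Hausdorff_space (euclidean :: cantor topology)"
proof -
  have "compact_space (euclidean :: bool topology)"
    by (simp add: finite_imp_compact compact_space_def)
  moreover have "\<exists>U V. open U \<and> open V \<and> x \<in> U \<and> y \<in> V \<and> disjnt U V" if "x \<noteq> y" for x y :: bool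
    using hausdorff[OF that] unfolding disjnt_def .
  then have "Hausdorff_space (euclidean :: bool topology)"
    unfolding Hausdorff_space_def by simp
  ultimately have "compact_space (product_topology (\<lambda>_. euclidean :: bool topology) (UNIV :: nat set))"
    and "Hausdorff_space (product_topology (\<lambda>_. euclidean :: bool topology) (UNIV :: nat set))"
    by (simp_all add: compact_space_product_topology Hausdorff_space_product_topology)
  then show "compact_space (euclidean :: cantor topology)"
    and "Hausdorff_space (euclidean :: cantor topology)"
    by (simp_all add: euclidean_product_topology)
qed

lemma no_perfect_square_in_Bstar:
  assumes "perfect_set P"
  shows "\<not> P \<times> P \<subseteq> Bstar \<pi>"
proof -
  define column :: "nat \<Rightarrow> cantor \<Rightarrow> cantor" where "column k y = (\<lambda>n. y (\<pi> (n, k)))" for k y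
  have "continuous_on UNIV (column k)" for k
    unfolding column_def by (intro continuous_on_coordinatewise_then_product) simp
  then have cont: "continuous_map euclidean euclidean f" if "f \<in> insert id (range column)" for f
    using that by auto
  have no_isolated: "\<not> openin (top_of_set P) {a}" for a
  proof
    assume a: "openin (top_of_set P) {a}"
    then obtain U where "open U" "U \<inter> P = {a}"
      by (metis openin_open inf_commute)
    then have "a isolated_in P"
      by (auto simp: isolated_in_def)
    then show False
      using assms by (auto simp: perfect_set_def)
  qed
  have "closedin euclidean P" "P \<noteq> {}"
    using assms by (auto simp: perfect_set_def)
  then obtain x y where "x \<in> P" "y \<in> P"
    and xy: "\<And>f. f \<in> insert id (range column) \<Longrightarrow> x \<noteq> f y \<and> y \<noteq> f x"
    using exists_pair_outside_graphs[OF compact_Hausdorff_cantor _ cont _ _ no_isolated]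
    by (metis countable_insert countableI_type countable_image)
  have "x \<noteq> y" "x \<noteq> column k y" "y \<noteq> column k x" for k
    using xy[of id] xy[of "column k"] by auto
  then have "(x, y) \<notin> Bstar \<pi>"
    by (auto simp: Bstar_def column_def fun_eq_iff)
  with \<open>x \<in> P\<close> \<open>y \<in> P\<close> show ?thesis
    by blast
qed

theorem proposition1p1:
  fixes \<pi> :: "nat \<times> nat \<Rightarrow> nat"
  assumes "bij \<pi>"
  shows "(\<exists>X :: cantor set. uncountable X \<and> X \<times> X \<subseteq> Bstar \<pi>) \<and>
         \<not> (\<exists>P :: cantor set. perfect_set P \<and> P \<times> P \<subseteq> Bstar \<pi>)"
  using exists_uncountable_square_in_Bstar[OF bij_is_inj[OF assms]] no_perfect_square_in_Bstar
  by blast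

end
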